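(* The relation $E^{\mathrm{ce}}_0$ is weak; that is, every equivalence relation $F^{\mathrm{ce}}$ on $\omega$ with $F^{\mathrm{ce}}\supseteq E^{\mathrm{ce}}_0$ that is universal is equal to $\mathrm{Id}_1$.
   Context: Fix a standard (acceptable) enumeration $(\varphi_e)_{e\in\omega}$ of the partial computable functions and let $W_e=\operatorname{dom}(\varphi_e)$. Write $e=^{\mathrm{ce}}e'$ iff $W_e=W_{e'}$, and $e\mathrel{E^{\mathrm{ce}}_0}e'$ iff the symmetric difference $W_e\mathbin{\triangle}W_{e'}$ is finite. $\mathrm{Id}_1$ is the one-class equivalence relation on $\omega$. An enumeration of a set $A$ is a surjection $\mu:\omega\to A$; $\mu[s]$ denotes the finite string $\mu(0),\dots,\mu(s-1)$. A learner is an arbitrary function $\mathbf{M}:\omega^{<\omega}\to\omega$ (no effectivity is assumed). For an equivalence relation $E^{\mathrm{ce}}$ on $\omega$ extending $=^{\mathrm{ce}}$, a family $\mathfrak{K}$ of nonempty c.e. sets is $E^{\mathrm{ce}}$-learnable if there is a learner $\mathbf{M}$ such that for every $e$ with $W_e\in\mathfrak{K}$ and every enumeration $\mu$ of $W_e$ there is $i\in\omega$ with $i\mathrel{E^{\mathrm{ce}}}e$ and $\mathbf{M}(\mu[s])=i$ for all sufficiently large $s$. $E^{\mathrm{ce}}$ is universal if every family of nonempty c.e. sets is $E^{\mathrm{ce}}$-learnable. An equivalence relation $E^{\mathrm{ce}}$ on $\omega$ extending $=^{\mathrm{ce}}$ is weak if every equivalence relation $F^{\mathrm{ce}}\supseteq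 E^{\mathrm{ce}}$ that is universal is equal to $\mathrm{Id}_1$. *)

theory Defs
  imports Main
begin

text \<open>
  Partial computable functions are Kleene's partial recursive functions on tuples of naturals,
  given by terms and a big-step semantics. Terms carry no arity: the arity is the length of the
  argument list a term is run on, and a term is undefined on lists of unsuitable length.
\<close>

datatype recf =
    Zero
  | Succ
  | Proj nat
  | Comp recf "recf list"
  | PrimRec recf recf
  | Mu recf

inductive computes :: "recf \<Rightarrow> nat list \<Rightarrow> nat \<Rightarrow> bool" where
  Zero: "computes Zero xs 0"
| Succ: "computes Succ [x] (Suc x)"
| Proj: "i < length xs \<Longrightarrow> computes (Proj i) xs (xs ! i)"
| Comp: "list_all2 (\<lambda>g y. computes g xs y) gs ys \<Longrightarrow> computes f ys z
           \<Longrightarrow> computes (Comp f gs) xs z"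
| PrimRec_0: "computes f xs y \<Longrightarrow> computes (PrimRec f g) (0 # xs) y"
| PrimRec_Suc: "computes (PrimRec f g) (n # xs) y \<Longrightarrow> computes g (n # y # xs) z
           \<Longrightarrow> computes (PrimRec f g) (Suc n # xs) z"
| Mu: "computes f (n # xs) 0 \<Longrightarrow> (\<And>m. m < n \<Longrightarrow> \<exists>y. computes f (m # xs) (Suc y))
           \<Longrightarrow> computes (Mu f) xs n"

definition partial_computable :: "(nat \<Rightarrow> nat option) \<Rightarrow> bool" where
  "partial_computable f \<longleftrightarrow> (\<exists>r. \<forall>x y. f x = Some y \<longleftrightarrow> computes r [x] y)"

definition partial_computable2 :: "(nat \<Rightarrow> nat \<Rightarrow> nat option) \<Rightarrow> bool" where
  "partial_computable2 f \<longleftrightarrow> (\<exists>r. \<forall>x y z. f x y = Some z \<longleftrightarrow> computes r [x, y] z)"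

text \<open>
  An acceptable enumeration in the sense of Rogers: it lists exactly the unary partial computable
  functions, has a partial computable universal function, and satisfies the s-m-n theorem (every
  partial computable family of unary functions is translated into it by a total computable map).
\<close>

definition acceptable :: "(nat \<Rightarrow> nat \<Rightarrow> nat option) \<Rightarrow> bool" where
  "acceptable \<phi> \<longleftrightarrow>
     range \<phi> = {f. partial_computable f} \<and>
     partial_computable2 \<phi> \<and>
     (\<forall>\<psi>. partial_computable2 \<psi> \<longrightarrow>
        (\<exists>h. partial_computable (\<lambda>e. Some (h e)) \<and> (\<forall>e. \<phi> (h e) = \<psi> e)))"

definition W :: "(nat \<Rightarrow> nat \<Rightarrow> nat option) \<Rightarrow> nat \<Rightarrow> nat set" where
  "W \<phi> e = dom (\<phi> e)"

definition eq_ce :: "(nat \<Rightarrow> nat \<Rightarrow> nat option) \<Rightarrow> (nat \<times> nat) set" where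
  "eq_ce \<phi> = {(e, e'). W \<phi> e = W \<phi> e'}"

definition E0_ce :: "(nat \<Rightarrow> nat \<Rightarrow> nat option) \<Rightarrow> (nat \<times> nat) set" where
  "E0_ce \<phi> = {(e, e'). finite ((W \<phi> e - W \<phi> e') \<union> (W \<phi> e' - W \<phi> e))}"

definition Id1 :: "(nat \<times> nat) set" where
  "Id1 = UNIV \<times> UNIV"

definition enumeration_of :: "(nat \<Rightarrow> nat) \<Rightarrow> nat set \<Rightarrow> bool" where
  "enumeration_of \<mu> A \<longleftrightarrow> range \<mu> = A"

definition initial_segment :: "(nat \<Rightarrow> nat) \<Rightarrow> nat \<Rightarrow> nat list" where
  "initial_segment \<mu> s = map \<mu> [0..<s]"

definition ce_equivalence :: "(nat \<Rightarrow> nat \<Rightarrow> nat option) \<Rightarrow> (nat \<times> nat) set \<Rightarrow> bool" where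
  "ce_equivalence \<phi> E \<longleftrightarrow> equiv UNIV E \<and> eq_ce \<phi> \<subseteq> E"

definition nonempty_ce_family :: "(nat \<Rightarrow> nat \<Rightarrow> nat option) \<Rightarrow> nat set set \<Rightarrow> bool" where
  "nonempty_ce_family \<phi> K \<longleftrightarrow> (\<forall>A\<in>K. A \<noteq> {} \<and> A \<in> range (W \<phi>))"

definition learnable ::
  "(nat \<Rightarrow> nat \<Rightarrow> nat option) \<Rightarrow> (nat \<times> nat) set \<Rightarrow> nat set set \<Rightarrow> bool" where
  "learnable \<phi> E K \<longleftrightarrow>
     (\<exists>M :: nat list \<Rightarrow> nat. \<forall>e \<mu>. W \<phi> e \<in> K \<longrightarrow> enumeration_of \<mu> (W \<phi> e) \<longrightarrow>
        (\<exists>i. (i, e) \<in> E \<and> (\<exists>s0. \<forall>s\<ge>s0. M (initial_segment \<mu> s) = i)))"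

definition universal :: "(nat \<Rightarrow> nat \<Rightarrow> nat option) \<Rightarrow> (nat \<times> nat) set \<Rightarrow> bool" where
  "universal \<phi> E \<longleftrightarrow> (\<forall>K. nonempty_ce_family \<phi> K \<longrightarrow> learnable \<phi> E K)"

definition weak :: "(nat \<Rightarrow> nat \<Rightarrow> nat option) \<Rightarrow> (nat \<times> nat) set \<Rightarrow> bool" where
  "weak \<phi> E \<longleftrightarrow> ce_equivalence \<phi> E \<and>
     (\<forall>F. equiv UNIV F \<and> E \<subseteq> F \<and> universal \<phi> F \<longrightarrow> F = Id1)"

end

theory Submission
  imports Defs
begin

text \<open>
  Let \<open>M\<close> learn all nonempty c.e. sets up to \<open>F\<close>. A Blum--Blum locking argument for \<open>\<omega>\<close> gives a
  string \<open>\<sigma>\<close> such that \<open>M\<close> is constant on all extensions of \<open>\<sigma>\<close>. Every c.e. set \<open>A\<close> differs only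
  finitely from a c.e. superset of the range of \<open>\<sigma>\<close>, and that superset has an enumeration
  beginning with \<open>\<sigma>\<close>; hence every index is \<open>F\<close>-equivalent to \<open>M \<sigma>\<close>.
\<close>

lemma computes_Zero_iff [simp]: "computes Zero xs y \<longleftrightarrow> y = 0"
  by (auto elim: computes.cases intro: computes.intros)

lemma computes_Succ_iff [simp]: "computes Succ [x] y \<longleftrightarrow> y = Suc x"
  by (auto elim: computes.cases intro: computes.intros)

lemma computes_Proj_iff [simp]: "computes (Proj i) xs y \<longleftrightarrow> i < length xs \<and> y = xs ! i"
  by (auto elim: computes.cases intro: computes.intros)

lemma computes_Comp_iff [simp]:
  "computes (Comp f gs) xs z \<longleftrightarrow> (\<exists>ys. list_all2 (\<lambda>g y. computes g xs y) gs ys \<and> computes f ys z)"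
  by (auto elim: computes.cases intro: computes.intros)

lemma computes_PrimRec_0_iff [simp]: "computes (PrimRec f g) (0 # xs) y \<longleftrightarrow> computes f xs y"
  by (auto elim: computes.cases intro: computes.intros)

lemma computes_PrimRec_Suc_iff [simp]:
  "computes (PrimRec f g) (Suc n # xs) z \<longleftrightarrow>
     (\<exists>y. computes (PrimRec f g) (n # xs) y \<and> computes g (n # y # xs) z)"
  by (auto elim: computes.cases intro: computes.intros)

text \<open>The number \<open>d\<close> is built into the term. Each \<open>PrimRec\<close> serves
  only as a case split that strips one successor: \<open>Proj 0\<close> picks the predecessor and
  ignores the recursive value.\<close>

primrec neq_recf :: "nat \<Rightarrow> recf" where
  "neq_recf 0 = PrimRec Zero (Comp Succ [Zero])"
| "neq_recf (Suc d) = PrimRec (Comp Succ [Zero]) (Comp (neq_recf d) [Proj 0])"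

lemma computes_neq_recf_iff [simp]:
  "computes (neq_recf d) [x] y \<longleftrightarrow> y = (if x = d then 0 else 1)"
proof (induction d arbitrary: x y)
  case 0
  show ?case
    by (induction x arbitrary: y) (auto simp: list_all2_Cons1)
next
  case (Suc d)
  show ?case
    by (induction x arbitrary: y) (auto simp: list_all2_Cons1 Suc.IH)
qed

text \<open>C.e. sets are handled as domains, so this is how a single point gets added to
  one.\<close>

lemma partial_computable_fun_upd:
  assumes "partial_computable f"
  shows "partial_computable (f(d \<mapsto> 0))"
proof -
  obtain r where r: "\<And>x y. f x = Some y \<longleftrightarrow> computes r [x] y"
    using assms by (auto simp: partial_computable_def)
  \<comment> \<open>\<open>Comp\<close> is strict, so the case distinction is a primitive recursion, which never runs \<open>r\<close> at \<open>d\<close>.\<close>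
  let ?r = "Comp (PrimRec Zero (Comp r [Proj 2])) [neq_recf d, Proj 0]"
  have "(f(d \<mapsto> 0)) x = Some y \<longleftrightarrow> computes ?r [x] y" for x y
    by (auto simp: list_all2_Cons1 r)
  then show ?thesis
    unfolding partial_computable_def by blast
qed

lemma range_W:
  assumes "acceptable \<phi>"
  shows "range (W \<phi>) = dom ` {f. partial_computable f}"
proof -
  have "range (W \<phi>) = dom ` range \<phi>"
    by (auto simp: W_def)
  then show ?thesis
    using assms by (simp add: acceptable_def)
qed

lemma UNIV_in_range_W:
  assumes "acceptable \<phi>"
  shows "UNIV \<in> range (W \<phi>)"
proof -
  have "partial_computable (\<lambda>_. Some 0)"
    unfolding partial_computable_def by (rule exI[of _ Zero]) auto
  moreover have "UNIV = dom (\<lambda>_::nat. Some (0::nat))"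
    by auto
  ultimately show ?thesis
    unfolding range_W[OF assms] by blast
qed

lemma insert_in_range_W:
  assumes "acceptable \<phi>" and "A \<in> range (W \<phi>)"
  shows "insert d A \<in> range (W \<phi>)"
proof -
  obtain f where f: "partial_computable f" "A = dom f"
    using assms(2) unfolding range_W[OF assms(1)] by blast
  have "insert d A = dom (f(d \<mapsto> 0))"
    by (simp add: f(2))
  then show ?thesis
    unfolding range_W[OF assms(1)] using partial_computable_fun_upd[OF f(1)] by blast
qed

lemma union_finite_in_range_W:
  assumes "acceptable \<phi>" and "A \<in> range (W \<phi>)" and "finite D"
  shows "A \<union> D \<in> range (W \<phi>)"
  using assms(3)
proof induction
  case empty
  then show ?case using assms(2) by simp
next
  case (insert d D)
  then show ?case using insert_in_range_W[OF assms(1), of "A \<union> D" d] by simp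
qed

lemma equiv_E0_ce: "equiv UNIV (E0_ce \<phi>)"
proof (rule equivI)
  show "trans (E0_ce \<phi>)"
  proof (rule transI)
    fix a b c
    assume "(a, b) \<in> E0_ce \<phi>" and "(b, c) \<in> E0_ce \<phi>"
    then have "finite (((W \<phi> a - W \<phi> b) \<union> (W \<phi> b - W \<phi> a)) \<union> ((W \<phi> b - W \<phi> c) \<union> (W \<phi> c - W \<phi> b)))"
      by (simp add: E0_ce_def)
    then have "finite ((W \<phi> a - W \<phi> c) \<union> (W \<phi> c - W \<phi> a))"
      by (rule rev_finite_subset) blast
    then show "(a, c) \<in> E0_ce \<phi>"
      by (simp add: E0_ce_def)
  qed
qed (auto simp: E0_ce_def refl_on_def sym_def)

text \<open>Strings of the chain agree wherever both are defined, so entry \<open>k\<close> of the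
  limit may be read off \<open>\<sigma> (Suc k)\<close>, which has more than \<open>k\<close>
  entries.\<close>

lemma limit_of_extending_lists:
  fixes \<sigma> :: "nat \<Rightarrow> 'a list"
  assumes ext: "\<And>n. \<exists>\<rho>. \<sigma> (Suc n) = \<sigma> n @ \<rho>" and len: "\<And>n. n \<le> length (\<sigma> n)"
  obtains \<mu> where "\<And>n. map \<mu> [0..<length (\<sigma> n)] = \<sigma> n"
proof
  have mono: "\<exists>\<rho>. \<sigma> n = \<sigma> m @ \<rho>" if "m \<le> n" for m n
    using that
  proof (induction rule: dec_induct)
    case (step n)
    then show ?case using ext[of n] by auto
  qed simp
  fix n
  show "map (\<lambda>k. \<sigma> (Suc k) ! k) [0..<length (\<sigma> n)] = \<sigma> n"
  proof (rule nth_equalityI)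
    fix k
    assume "k < length (map (\<lambda>k. \<sigma> (Suc k) ! k) [0..<length (\<sigma> n)])"
    then have k: "k < length (\<sigma> n)" "k < length (\<sigma> (Suc k))"
      using len[of "Suc k"] by auto
    have "\<sigma> (Suc k) ! k = \<sigma> n ! k"
      using mono[of "Suc k" n] mono[of n "Suc k"] k by (cases "Suc k \<le> n") (auto simp: nth_append)
    then show "map (\<lambda>k. \<sigma> (Suc k) ! k) [0..<length (\<sigma> n)] ! k = \<sigma> n ! k"
      using k by simp
  qed simp
qed

text \<open>Otherwise every string has an extension on which \<open>M\<close> changes its value, and
  chaining these yields an enumeration of all numbers on which \<open>M\<close> never
  settles.\<close>

lemma locking_string_UNIV:
  fixes M :: "nat list \<Rightarrow> 'a"
  assumes conv: "\<And>\<mu>. enumeration_of \<mu> UNIV \<Longrightarrow> \<exists>i s0. \<forall>s\<ge>s0. M (initial_segment \<mu> s) = i"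
  obtains \<sigma> where "\<And>\<rho>. M (\<sigma> @ \<rho>) = M \<sigma>"
proof (rule ccontr)
  assume "\<not> thesis"
  then have "\<forall>\<sigma>. \<exists>\<rho>. M (\<sigma> @ \<rho>) \<noteq> M \<sigma>"
    using that by blast
  then obtain x where x: "\<And>\<sigma>. M (\<sigma> @ x \<sigma>) \<noteq> M \<sigma>"
    by metis
  \<comment> \<open>The entry \<open>n\<close> makes the limit surjective; the block
    \<open>x\<close> then forces a change of value.\<close>
  define \<tau> where "\<tau> = rec_nat [] (\<lambda>n \<sigma>. (\<sigma> @ [n]) @ x (\<sigma> @ [n]))"
  have \<tau>_Suc: "\<tau> (Suc n) = (\<tau> n @ [n]) @ x (\<tau> n @ [n])" for n
    by (simp add: \<tau>_def)
  have len: "n \<le> length (\<tau> n)" for n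
    by (induction n) (auto simp: \<tau>_Suc)
  obtain \<mu> where \<mu>: "\<And>n. map \<mu> [0..<length (\<tau> n)] = \<tau> n"
    using limit_of_extending_lists[of \<tau>] len by (auto simp: \<tau>_Suc)
  \<comment> \<open>The string just before the block \<open>x\<close> is itself an initial segment
    of \<open>\<mu>\<close>.\<close>
  have snoc: "map \<mu> [0..<Suc (length (\<tau> n))] = \<tau> n @ [n]" for n
  proof -
    have "map \<mu> [0..<Suc (length (\<tau> n))] = take (Suc (length (\<tau> n))) (map \<mu> [0..<length (\<tau> (Suc n))])"
      by (simp add: take_map \<tau>_Suc del: upt_Suc)
    also have "\<dots> = \<tau> n @ [n]"
      unfolding \<mu> by (simp add: \<tau>_Suc)
    finally show ?thesis .
  qed
  have "\<mu> (length (\<tau> n)) = n" for n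
    using snoc[of n] by simp
  then have "enumeration_of \<mu> UNIV"
    unfolding enumeration_of_def by (rule surjI)
  then obtain i s0 where i: "\<And>s. s \<ge> s0 \<Longrightarrow> M (initial_segment \<mu> s) = i"
    using conv by blast
  \<comment> \<open>Stage \<open>s0\<close> starts at a length of at least \<open>s0\<close>, so
    both ends of its block lie where \<open>M\<close> has already settled.\<close>
  have "M (\<tau> s0 @ [s0]) = i"
    using i[of "Suc (length (\<tau> s0))"] len[of s0] snoc[of s0]
    by (simp add: initial_segment_def del: upt_Suc)
  moreover have "M ((\<tau> s0 @ [s0]) @ x (\<tau> s0 @ [s0])) = i"
    using i[of "length (\<tau> (Suc s0))"] len[of "Suc s0"] \<mu>[of "Suc s0"]
    by (simp add: initial_segment_def \<tau>_Suc)
  ultimately show False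
    using x[of "\<tau> s0 @ [s0]"] by simp
qed

text \<open>After \<open>\<sigma>\<close>, the position \<open>length \<sigma> + b\<close> lists
  \<open>b\<close> if \<open>b\<close> is in \<open>A\<close>, and the default \<open>a\<close>
  otherwise.\<close>

lemma enumeration_extending_string:
  assumes "set \<sigma> \<subseteq> A" and "A \<noteq> {}"
  obtains \<mu> where "enumeration_of \<mu> A" and "initial_segment \<mu> (length \<sigma>) = \<sigma>"
proof -
  obtain a where a: "a \<in> A"
    using assms(2) by blast
  define \<mu> where "\<mu> n = (if n < length \<sigma> then \<sigma> ! n
    else if n - length \<sigma> \<in> A then n - length \<sigma> else a)" for n
  have "\<mu> n \<in> A" for n
    using assms(1) a by (auto simp: \<mu>_def)
  moreover have "b \<in> range \<mu>" if "b \<in> A" for b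
    using that by (intro range_eqI[of _ _ "length \<sigma> + b"]) (simp add: \<mu>_def)
  ultimately have "enumeration_of \<mu> A"
    unfolding enumeration_of_def by blast
  moreover have "initial_segment \<mu> (length \<sigma>) = \<sigma>"
    unfolding initial_segment_def by (rule nth_equalityI) (simp_all add: \<mu>_def)
  ultimately show thesis
    by (rule that)
qed

lemma universal_extending_E0_ce_eq_Id1:
  assumes acc: "acceptable \<phi>" and F: "equiv UNIV F" "E0_ce \<phi> \<subseteq> F" and univ: "universal \<phi> F"
  shows "F = Id1"
proof -
  have "sym F" and "trans F"
    using F(1) by (auto elim: equivE)
  have "learnable \<phi> F (range (W \<phi>) - {{}})"
    using univ by (simp add: universal_def nonempty_ce_family_def)
  then obtain M where "\<forall>e \<mu>. W \<phi> e \<in> range (W \<phi>) - {{}} \<longrightarrow> enumeration_of \<mu> (W \<phi> e) \<longrightarrow>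
      (\<exists>i. (i, e) \<in> F \<and> (\<exists>s0. \<forall>s\<ge>s0. M (initial_segment \<mu> s) = i))"
    unfolding learnable_def by (elim exE)
  then have M: "\<exists>i. (i, e) \<in> F \<and> (\<exists>s0. \<forall>s\<ge>s0. M (initial_segment \<mu> s) = i)"
    if "W \<phi> e \<noteq> {}" "enumeration_of \<mu> (W \<phi> e)" for e \<mu>
    using that by simp
  obtain u where "UNIV = W \<phi> u"
    using UNIV_in_range_W[OF acc] by blast
  \<comment> \<open>An index of \<open>UNIV\<close> yields convergence of \<open>M\<close> on every
    enumeration of \<open>UNIV\<close>.\<close>
  then have "\<exists>i s0. \<forall>s\<ge>s0. M (initial_segment \<mu> s) = i" if "enumeration_of \<mu> UNIV" for \<mu>
    using M[of u \<mu>] that by auto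
  then obtain \<sigma> where \<sigma>: "\<And>\<rho>. M (\<sigma> @ \<rho>) = M \<sigma>"
    using locking_string_UNIV by blast
  have all: "(M \<sigma>, e) \<in> F" for e
  proof -
    \<comment> \<open>Adding \<open>0\<close> keeps the set nonempty when both \<open>W\<^sub>e\<close> and \<open>\<sigma>\<close> are empty.\<close>
    define D where "D = insert 0 (set \<sigma>)"
    have "W \<phi> e \<union> D \<in> range (W \<phi>)"
      using acc by (rule union_finite_in_range_W) (simp_all add: D_def)
    then obtain b where b: "W \<phi> b = W \<phi> e \<union> D"
      by (metis rangeE)
    then have "set \<sigma> \<subseteq> W \<phi> b" and nonempty: "W \<phi> b \<noteq> {}"
      by (auto simp: D_def)
    then obtain \<mu> where \<mu>: "enumeration_of \<mu> (W \<phi> b)" "initial_segment \<mu> (length \<sigma>) = \<sigma>"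
      by (rule enumeration_extending_string)
    obtain i s0 where i: "(i, b) \<in> F" "\<And>s. s \<ge> s0 \<Longrightarrow> M (initial_segment \<mu> s) = i"
      using M[OF nonempty \<mu>(1)] by blast
    \<comment> \<open>This segment is long enough for \<open>M\<close> to have reached its limit
      \<open>i\<close>, yet it extends \<open>\<sigma>\<close>, where \<open>M\<close> is
      locked.\<close>
    have "initial_segment \<mu> (length \<sigma> + s0) = \<sigma> @ map \<mu> [length \<sigma>..<length \<sigma> + s0]"
      using \<mu>(2) by (simp add: initial_segment_def upt_add_eq_append[OF le0])
    then have "i = M \<sigma>"
      using i(2)[of "length \<sigma> + s0"] \<sigma> by simp
    moreover have "(b, e) \<in> F"
    proof -
      have "finite ((W \<phi> b - W \<phi> e) \<union> (W \<phi> e - W \<phi> b))"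
        by (rule finite_subset[of _ D]) (auto simp: b D_def)
      then show ?thesis
        using F(2) by (auto simp: E0_ce_def)
    qed
    ultimately show ?thesis
      using i(1) transD[OF \<open>trans F\<close>] by blast
  qed
  have "(e, e') \<in> F" for e e'
    using symD[OF \<open>sym F\<close> all] all by (rule transD[OF \<open>trans F\<close>])
  then show ?thesis
    by (auto simp: Id1_def)
qed

theorem theorem5p3:
  fixes \<phi> :: "nat \<Rightarrow> nat \<Rightarrow> nat option"
  assumes "acceptable \<phi>"
  shows "weak \<phi> (E0_ce \<phi>)"
proof -
  have "eq_ce \<phi> \<subseteq> E0_ce \<phi>"
    by (auto simp: eq_ce_def E0_ce_def)
  then show ?thesis
    using equiv_E0_ce universal_extending_E0_ce_eq_Id1[OF assms]
    by (simp add: weak_def ce_equivalence_def)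
qed

end
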